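(* Let $m\ge2$, $n\ge1$. The following three statements are true. (i) The set $\Sigma:=\{(K,\mathbf q,\mathcal A,\mathbf x)\in C(\mathbb R^n)\times\mathbb R^n\times\mathcal T_{m,n}\times\mathbb R^n:\ \mathbf x\in{\rm SOL}(K,\mathbf q,\mathcal A)\}$ is closed in the product space $C(\mathbb R^n)\times\mathbb R^n\times\mathcal T_{m,n}\times\mathbb R^n$. (ii) Let $(\bar K,\bar{\mathbf q},\bar{\mathcal A})\in C(\mathbb R^n)\times\mathbb R^n\times\mathcal T_{m,n}$. If $\bar{\mathcal A}$ is $\bar K$-regular, then $\bigcup_{(K,\mathbf q,\mathcal A)\in\mathcal N}{\rm SOL}(K,\mathbf q,\mathcal A)$ is bounded for some neighborhood $\mathcal N$ of $(\bar K,\bar{\mathbf q},\bar{\mathcal A})$. (iii) Let $(\bar K,\bar{\mathbf q},\bar{\mathcal A})\in C(\mathbb R^n)\times\mathbb R^n\times\mathcal T_{m,n}$. If $\bar{\mathcal A}$ is $\bar K$-regular, then the map ${\rm SOL}(\cdot,\cdot,\cdot):C(\mathbb R^n)\times\mathbb R^n\times\mathcal T_{m,n}\to2^{\mathbb R^n}$ is upper-semicontinuous at $(\bar K,\bar{\mathbf q},\bar{\mathcal A})$.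
   Context: $C(\mathbb R^n)$ is the set of nonzero closed convex cones in $\mathbb R^n$ with the metric $\delta(K_1,K_2)=\sup_{\|\mathbf z\|\le1}|{\rm dist}(\mathbf z,K_1)-{\rm dist}(\mathbf z,K_2)|$, where ${\rm dist}(\mathbf z,K)=\inf_{\mathbf u\in K}\|\mathbf z-\mathbf u\|$. $\mathcal T_{m,n}$ is the space of real $m$-th order $n$-dimensional tensors $\mathcal A=(a_{i_1\ldots i_m})_{1\le i_1,\ldots,i_m\le n}$ with the Frobenius norm $\|\mathcal A\|_F=(\sum a_{i_1\ldots i_m}^2)^{1/2}$. For $\mathbf x\in\mathbb R^n$, $\mathcal A\mathbf x^{m-1}\in\mathbb R^n$ has components $(\mathcal A\mathbf x^{m-1})_i=\sum_{i_2,\ldots,i_m=1}^n a_{ii_2\ldots i_m}x_{i_2}\cdots x_{i_m}$, and $\mathcal A\mathbf x^m=\mathbf x^\top\mathcal A\mathbf x^{m-1}$. For $K\in C(\mathbb R^n)$, $K^*=\{\mathbf y:\langle\mathbf y,\mathbf x\rangle\ge0\ \forall \mathbf x\in K\}$ and $${\rm SOL}(K,\mathbf q,\mathcal A)=\{\mathbf x\in K:\ \mathcal A\mathbf x^{m-1}+\mathbf q\in K^*,\ \langle\mathbf x,\mathcal A\mathbf x^{m-1}+\mathbf q\rangle=0\}.$$ $\mathcal A$ is $K$-regular if $\mathcal A\mathbf x^m\neq0$ for all $\mathbf x\in K\setminus\{\mathbf0\}$. A set-valued map $\Psi:W\to2^Y$ between topological spaces is upper-semicontinuous at $\bar w$ if,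 whenever $U\subseteq Y$ is open with $\Psi(\bar w)\subseteq U$, then $\Psi(w)\subseteq U$ for each $w$ in some neighborhood of $\bar w$. *)

theory Defs
  imports "HOL-Analysis.Analysis"
begin

text \<open>
  The library predicate \<^const>\<open>convex_cone\<close> includes nonemptiness and stability under
  multiplication by all nonnegative scalars.
\<close>

typedef (overloaded) 'n ccone = "{K :: (real^'n::finite) set. closed K \<and> convex_cone K \<and> K \<noteq> {0}}"
  morphisms cone_set Abs_ccone
proof
  have "(1 :: real^'n) \<noteq> 0" by simp
  then have "(UNIV :: (real^'n) set) \<noteq> {0}" by blast
  then show "UNIV \<in> {K :: (real^'n) set. closed K \<and> convex_cone K \<and> K \<noteq> {0}}"
    by (simp add: convex_cone_def conic_def)
qed

lemma closed_cone_set: "closed (cone_set K)"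
  and convex_cone_cone_set: "convex_cone (cone_set K)"
  and cone_set_nonzero: "cone_set K \<noteq> {0}"
  using cone_set[of K] by auto

lemma zero_in_cone_set: "0 \<in> cone_set K"
  using convex_cone_cone_set[of K] by (simp add: convex_cone_contains_0)

definition cone_delta :: "(real^'n) set \<Rightarrow> (real^'n) set \<Rightarrow> real"
  where "cone_delta K1 K2 = (SUP z \<in> cball 0 1. \<bar>infdist z K1 - infdist z K2\<bar>)"

lemma bdd_above_cone_delta:
  fixes K1 K2 :: "(real^'n) set"
  assumes "0 \<in> K1" "0 \<in> K2"
  shows "bdd_above ((\<lambda>z. \<bar>infdist z K1 - infdist z K2\<bar>) ` cball 0 1)"
proof (rule bdd_aboveI2)
  fix z :: "real^'n" assume "z \<in> cball 0 1"
  then have "infdist z K1 \<le> 1" "infdist z K2 \<le> 1"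
    using infdist_le[OF assms(1), of z] infdist_le[OF assms(2), of z] by auto
  then show "\<bar>infdist z K1 - infdist z K2\<bar> \<le> 1"
    using infdist_nonneg[of z K1] infdist_nonneg[of z K2] by linarith
qed

lemma infdist_diff_le_cone_delta:
  assumes "0 \<in> K1" "0 \<in> K2" "norm z \<le> 1"
  shows "\<bar>infdist z K1 - infdist z K2\<bar> \<le> cone_delta K1 K2"
  unfolding cone_delta_def
  by (rule cSUP_upper[OF _ bdd_above_cone_delta]) (use assms in auto)

lemma cone_delta_zero_subset:
  fixes K1 K2 :: "(real^'n) set"
  assumes "convex_cone K1" "convex_cone K2" "closed K2" "cone_delta K1 K2 = 0"
  shows "K1 \<subseteq> K2"
proof
  fix x assume x: "x \<in> K1"
  have 0: "0 \<in> K1" "0 \<in> K2" using assms convex_cone_contains_0 by blast+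
  show "x \<in> K2"
  proof (cases "x = 0")
    case False
    define z where "z = inverse (norm x) *\<^sub>R x"
    have "z \<in> K1"
      using assms(1) x unfolding z_def convex_cone_def by (simp add: conicD)
    moreover have "norm z \<le> 1" using False by (simp add: z_def)
    ultimately have "infdist z K2 = 0"
      using infdist_diff_le_cone_delta[OF 0, of z] assms(4) by simp
    then have "z \<in> K2"
      using in_closed_iff_infdist_zero[of K2 z] assms(3) 0 by auto
    then have "norm x *\<^sub>R z \<in> K2"
      using assms(2) unfolding convex_cone_def by (simp add: conicD)
    then show ?thesis using False by (simp add: z_def)
  qed (use 0 in simp)
qed

instantiation ccone :: (finite) metric_space
begin

definition dist_ccone :: "'a ccone \<Rightarrow> 'a ccone \<Rightarrow> real"
  where "dist_ccone K1 K2 = cone_delta (cone_set K1) (cone_set K2)"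

definition uniformity_ccone :: "('a ccone \<times> 'a ccone) filter"
  where "uniformity_ccone = (INF e\<in>{0<..}. principal {(x, y). dist x y < e})"

definition open_ccone :: "'a ccone set \<Rightarrow> bool"
  where "open_ccone U \<longleftrightarrow> (\<forall>x\<in>U. \<forall>\<^sub>F (x', y) in uniformity. x' = x \<longrightarrow> y \<in> U)"

instance
proof
  fix x y z :: "'a ccone"
  have sym: "cone_delta (cone_set x) (cone_set y) = cone_delta (cone_set y) (cone_set x)"
    by (simp add: cone_delta_def abs_minus_commute)
  show "dist x y = 0 \<longleftrightarrow> x = y"
  proof
    assume "dist x y = 0"
    then have "cone_set x = cone_set y"
      unfolding dist_ccone_def using sym
      by (intro equalityI cone_delta_zero_subset convex_cone_cone_set closed_cone_set) auto
    then show "x = y" by (simp add: cone_set_inject)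
  next
    assume "x = y"
    then show "dist x y = 0" by (simp add: dist_ccone_def cone_delta_def)
  qed
  show "dist x y \<le> dist x z + dist y z"
    unfolding dist_ccone_def
  proof (subst cone_delta_def, rule cSUP_least)
    fix v :: "real^'a" assume "v \<in> cball 0 1"
    then have "norm v \<le> 1" by simp
    with infdist_diff_le_cone_delta[of "cone_set x" "cone_set z" v]
      infdist_diff_le_cone_delta[of "cone_set y" "cone_set z" v]
    show "\<bar>infdist v (cone_set x) - infdist v (cone_set y)\<bar>
        \<le> cone_delta (cone_set x) (cone_set z) + cone_delta (cone_set y) (cone_set z)"
      by (simp add: zero_in_cone_set)
  qed simp
qed (rule uniformity_ccone_def open_ccone_def)+

end

text \<open>
  The order \<open>m\<close> and dimension \<open>n\<close> are the cardinalities of the index types \<open>'m\<close> and \<open>'n\<close>.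
  The entry with indices \<open>i\<^sub>1, \<dots>, i\<^sub>m\<close> is the component at the multi-index
  \<open>i :: 'm \<Rightarrow> 'n\<close>, where the linear order on \<open>'m\<close> says which position comes first.
  The norm of this vector type is the Frobenius norm.
\<close>

type_synonym ('m, 'n) tensor = "real^('m \<Rightarrow> 'n)"

lemma norm_tensor:
  fixes A :: "('m::finite, 'n::finite) tensor"
  shows "norm A = sqrt (\<Sum>i\<in>UNIV. (A $ i)\<^sup>2)"
  by (simp add: norm_vec_def L2_set_def)

definition first_pos :: "'m::{finite,linorder}"
  where "first_pos = Min UNIV"

definition tensor_apply ::
  "('m::{finite,linorder}, 'n::finite) tensor \<Rightarrow> real^'n \<Rightarrow> real^'n"
  where "tensor_apply A x =
    (\<chi> j. \<Sum>i | i first_pos = j. A $ i * (\<Prod>k\<in>UNIV - {first_pos}. x $ (i k)))"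

definition tensor_form ::
  "('m::{finite,linorder}, 'n::finite) tensor \<Rightarrow> real^'n \<Rightarrow> real"
  where "tensor_form A x = x \<bullet> tensor_apply A x"

definition dual_cone :: "(real^'n::finite) set \<Rightarrow> (real^'n) set"
  where "dual_cone K = {y. \<forall>x\<in>K. y \<bullet> x \<ge> 0}"

definition SOL ::
  "'n::finite ccone \<Rightarrow> real^'n \<Rightarrow> ('m::{finite,linorder}, 'n) tensor \<Rightarrow> (real^'n) set"
  where "SOL K q A = {x \<in> cone_set K. tensor_apply A x + q \<in> dual_cone (cone_set K) \<and>
    x \<bullet> (tensor_apply A x + q) = 0}"

definition regular ::
  "'n::finite ccone \<Rightarrow> ('m::{finite,linorder}, 'n) tensor \<Rightarrow> bool"
  where "regular K A \<longleftrightarrow> (\<forall>x \<in> cone_set K - {0}. tensor_form A x \<noteq> 0)"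

definition upper_semicontinuous_at ::
  "('w::topological_space \<Rightarrow> 'y::topological_space set) \<Rightarrow> 'w \<Rightarrow> bool"
  where "upper_semicontinuous_at \<Psi> w0 \<longleftrightarrow>
    (\<forall>U. open U \<and> \<Psi> w0 \<subseteq> U \<longrightarrow> (\<forall>\<^sub>F w in nhds w0. \<Psi> w \<subseteq> U))"

end

theory Submission
  imports Defs
begin

text \<open>
  The metric on cones is made so that the distance \<open>(K, z) \<mapsto> dist(z, K)\<close> is jointly
  continuous: on the unit ball the distances to two cones differ by at most \<open>\<delta>(K\<^sub>1, K\<^sub>2)\<close>, and
  distances to a cone are positively homogeneous, so for arbitrary \<open>z\<close> they differ by at most
  \<open>\<parallel>z\<parallel> \<delta>(K\<^sub>1, K\<^sub>2)\<close> (\<open>infdist_cone_set_diff_le\<close>). Both conic conditions in the complementarity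
  problem are equations between such distances: \<open>x \<in> K\<close> says \<open>dist(x, K) = 0\<close>, and
  \<open>y \<in> K\<^sup>*\<close> says that \<open>0\<close> is a nearest point of \<open>K\<close> to \<open>-y\<close>, that is \<open>dist(-y, K) = \<parallel>y\<parallel>\<close>
  (\<open>dual_cone_iff_infdist\<close>). The graph of the solution map is therefore the solution set of
  equations between continuous functions, hence closed.

  For local boundedness, rescale a nonzero solution \<open>x\<close> to \<open>u = x / \<parallel>x\<parallel>\<close> and put
  \<open>t = 1 / \<parallel>x\<parallel>\<close>. Since \<open>A x\<^sup>m\<^sup>-\<^sup>1\<close> is homogeneous of degree \<open>m - 1\<close>, the complementarity equation
  turns into \<open>A u\<^sup>m + t\<^sup>m\<^sup>-\<^sup>1 \<langle>u, q\<rangle> = 0\<close>. As \<open>m \<ge> 2\<close>, this equation still makes sense, and is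
  continuous, at \<open>t = 0\<close>, where it says \<open>A u\<^sup>m = 0\<close>; regularity excludes exactly that for unit
  vectors of the cone. Compactness of the unit sphere, in the form of the tube lemma, excludes it
  also for all nearby data and all small \<open>t\<close>, i.e. nearby problems have no large solutions.

  Upper semicontinuity follows from these two facts, as for any locally bounded set-valued map
  with closed graph: the tube lemma separates the graph from the compact part of the complement
  of \<open>U\<close> in which the values of the map could lie.
\<close>

section \<open>Distance to a cone\<close>

lemma infdist_conic_scale_le:
  fixes K :: "'a::real_normed_vector set"
  assumes "conic K" "K \<noteq> {}" "c > 0"
  shows "infdist (c *\<^sub>R z) K \<le> c * infdist z K"
proof -
  have "infdist (c *\<^sub>R z) K / c \<le> (INF k\<in>K. dist z k)"
  proof (rule cINF_greatest)
    fix k assume "k \<in> K"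
    then have "c *\<^sub>R k \<in> K" using assms by (simp add: conicD)
    then have "infdist (c *\<^sub>R z) K \<le> dist (c *\<^sub>R z) (c *\<^sub>R k)" by (rule infdist_le)
    then show "infdist (c *\<^sub>R z) K / c \<le> dist z k"
      using \<open>c > 0\<close>
      by (simp add: dist_norm scaleR_diff_right[symmetric] divide_le_eq mult.commute)
  qed (rule assms)
  then show ?thesis
    using assms by (simp add: infdist_def divide_le_eq mult.commute)
qed

lemma infdist_conic_scale:
  fixes K :: "'a::real_normed_vector set"
  assumes "conic K" "K \<noteq> {}" "c > 0"
  shows "infdist (c *\<^sub>R z) K = c * infdist z K"
proof (rule antisym)
  show "infdist (c *\<^sub>R z) K \<le> c * infdist z K"
    by (rule infdist_conic_scale_le[OF assms])
  have "infdist (inverse c *\<^sub>R (c *\<^sub>R z)) K \<le> inverse c * infdist (c *\<^sub>R z) K"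
    by (rule infdist_conic_scale_le) (use assms in auto)
  then show "c * infdist z K \<le> infdist (c *\<^sub>R z) K"
    using \<open>c > 0\<close> by (simp add: field_simps)
qed

lemma conic_cone_set: "conic (cone_set K)"
  using convex_cone_cone_set[of K] by (simp add: convex_cone_def)

lemma cone_set_nonempty: "cone_set K \<noteq> {}"
  using zero_in_cone_set by blast

lemma infdist_cone_set_diff_le:
  "\<bar>infdist z (cone_set K1) - infdist z (cone_set K2)\<bar> \<le> norm z * dist K1 K2"
proof (cases "z = 0")
  case True
  then show ?thesis by (simp add: zero_in_cone_set)
next
  case False
  define v where "v = inverse (norm z) *\<^sub>R z"
  have z: "z = norm z *\<^sub>R v" and v: "norm v \<le> 1"
    using False by (simp_all add: v_def)
  have scale: "infdist z (cone_set K) = norm z * infdist v (cone_set K)" for K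
    using infdist_conic_scale[OF conic_cone_set cone_set_nonempty, of "norm z" v K] z False
    by simp
  have "\<bar>infdist v (cone_set K1) - infdist v (cone_set K2)\<bar> \<le> dist K1 K2"
    unfolding dist_ccone_def using v
    by (intro infdist_diff_le_cone_delta zero_in_cone_set)
  then show ?thesis
    unfolding scale right_diff_distrib[symmetric] abs_mult
    by (simp add: mult_left_mono)
qed

lemma tendsto_infdist_cone_set:
  assumes K: "(K \<longlongrightarrow> K0) F" and z: "(z \<longlongrightarrow> z0) F"
  shows "((\<lambda>p. infdist (z p) (cone_set (K p))) \<longlongrightarrow> infdist z0 (cone_set K0)) F"
proof -
  have "((\<lambda>p. norm (z p) * dist (K p) K0) \<longlongrightarrow> norm z0 * dist K0 K0) F"
    by (intro tendsto_intros K z)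
  then have "((\<lambda>p. norm (z p) * dist (K p) K0) \<longlongrightarrow> 0) F" by simp
  then have "((\<lambda>p. infdist (z p) (cone_set (K p)) - infdist (z p) (cone_set K0)) \<longlongrightarrow> 0) F"
    by (rule Lim_null_comparison[rotated])
      (simp add: infdist_cone_set_diff_le)
  moreover have "((\<lambda>p. infdist (z p) (cone_set K0)) \<longlongrightarrow> infdist z0 (cone_set K0)) F"
    by (intro tendsto_infdist z)
  ultimately show ?thesis
    using tendsto_add by fastforce
qed

lemma continuous_on_infdist_cone_set [continuous_intros]:
  assumes "continuous_on S K" "continuous_on S z"
  shows "continuous_on S (\<lambda>p. infdist (z p) (cone_set (K p)))"
  using assms by (simp add: continuous_on_def tendsto_infdist_cone_set)

lemma in_cone_set_iff_infdist: "x \<in> cone_set K \<longleftrightarrow> infdist x (cone_set K) = 0"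
  by (rule in_closed_iff_infdist_zero[OF closed_cone_set cone_set_nonempty])

text \<open>
  If \<open>y\<close> has a negative inner product with some \<open>k \<in> K\<close>, then moving from \<open>0\<close> along \<open>k\<close> at first
  decreases the distance to \<open>-y\<close>; otherwise every point of \<open>K\<close> is at least as far from \<open>-y\<close>
  as \<open>0\<close> is.
\<close>

lemma dual_cone_iff_infdist:
  fixes K :: "(real^'n) set"
  assumes "conic K" "0 \<in> K"
  shows "y \<in> dual_cone K \<longleftrightarrow> infdist (- y) K = norm y"
proof
  assume y: "y \<in> dual_cone K"
  have "norm y \<le> (INF k\<in>K. dist (- y) k)"
  proof (rule cINF_greatest)
    fix k assume "k \<in> K"
    then have "0 \<le> y \<bullet> k" using y by (simp add: dual_cone_def)
    then have "(norm y)\<^sup>2 \<le> (norm (y + k))\<^sup>2"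
      unfolding power2_norm_eq_inner inner_add_left inner_add_right
      using inner_commute[of k y] inner_ge_zero[of k] by linarith
    then have "norm y \<le> norm (y + k)"
      by (rule power2_le_imp_le) simp
    moreover have "dist (- y) k = norm (y + k)"
      using dist_minus[of y "- k"] by (simp add: dist_norm)
    ultimately show "norm y \<le> dist (- y) k" by simp
  qed (use assms in auto)
  moreover have "infdist (- y) K = (INF k\<in>K. dist (- y) k)"
    using assms(2) by (intro infdist_notempty) blast
  moreover have "infdist (- y) K \<le> norm y"
    using infdist_le[OF assms(2), of "- y"] by simp
  ultimately show "infdist (- y) K = norm y" by linarith
next
  assume y: "infdist (- y) K = norm y"
  have "0 \<le> y \<bullet> k" if k: "k \<in> K" for k
  proof (rule ccontr)
    assume neg: "\<not> 0 \<le> y \<bullet> k"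
    then have "k \<noteq> 0" by auto
    then have kk: "k \<bullet> k > 0" by simp
    \<comment> \<open>\<open>t k\<close> is the orthogonal projection of \<open>- y\<close> onto the line spanned by \<open>k\<close>.\<close>
    define t where "t = - (y \<bullet> k) / (k \<bullet> k)"
    have "t > 0" unfolding t_def using neg kk by (simp add: divide_neg_pos)
    then have "t *\<^sub>R k \<in> K" using assms(1) k by (simp add: conicD)
    then have "norm y \<le> dist (- y) (t *\<^sub>R k)"
      using infdist_le[of "t *\<^sub>R k" K "- y"] y by simp
    also have "\<dots> = norm (- y - t *\<^sub>R k)" by (simp add: dist_norm)
    finally have "(norm y)\<^sup>2 \<le> (norm (- y - t *\<^sub>R k))\<^sup>2"
      by (simp add: power_mono)
    also have "\<dots> = (norm y)\<^sup>2 + t * (2 * (y \<bullet> k) + t * (k \<bullet> k))"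
      unfolding power2_norm_eq_inner inner_diff_left inner_diff_right
      by (simp add: inner_commute[of k y] algebra_simps)
    also have "t * (k \<bullet> k) = - (y \<bullet> k)" using kk by (simp add: t_def)
    finally have "0 \<le> t * (y \<bullet> k)" by simp
    then show False using \<open>t > 0\<close> neg by (simp add: zero_le_mult_iff)
  qed
  then show "y \<in> dual_cone K" by (simp add: dual_cone_def)
qed

section \<open>Continuity and homogeneity of the tensor map\<close>

lemma continuous_on_tensor_apply [continuous_intros]:
  assumes "continuous_on S A" "continuous_on S x"
  shows "continuous_on S (\<lambda>p. tensor_apply (A p) (x p))"
  unfolding tensor_apply_def by (intro continuous_intros assms)

lemma tensor_apply_scaleR:
  fixes A :: "('m::{finite,linorder}, 'n::finite) tensor"
  shows "tensor_apply A (c *\<^sub>R x) = c ^ (CARD('m) - 1) *\<^sub>R tensor_apply A x"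
  by (simp add: tensor_apply_def vec_eq_iff prod.distrib sum_distrib_left card_Diff_singleton
      mult_ac)

section \<open>The solution map\<close>

text \<open>Every condition defining a solution is an equation between continuous functions.\<close>

lemma closed_graph_SOL:
  "closed {(K :: 'n::finite ccone, q, A :: ('m::{finite,linorder}, 'n) tensor, x).
     x \<in> SOL K q A}"
proof -
  have "{(K :: 'n ccone, q, A :: ('m, 'n) tensor, x). x \<in> SOL K q A} =
    {(K, q, A, x). infdist x (cone_set K) = 0
      \<and> infdist (- (tensor_apply A x + q)) (cone_set K) = norm (tensor_apply A x + q)
      \<and> x \<bullet> (tensor_apply A x + q) = 0}"
    by (simp only: SOL_def mem_Collect_eq in_cone_set_iff_infdist
        dual_cone_iff_infdist[OF conic_cone_set zero_in_cone_set])
  also have "closed \<dots>"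
    unfolding case_prod_unfold
    by (intro closed_Collect_conj closed_Collect_eq continuous_intros)
  finally show ?thesis .
qed

text \<open>
  The normalized equation of a solution \<open>x = u / t\<close>; it extends to \<open>t = 0\<close>, which stands for
  solutions at infinity.
\<close>

lemma SOL_normalized:
  fixes A :: "('m::{finite,linorder}, 'n::finite) tensor"
  assumes x: "x \<in> SOL K q A" and t: "t > 0"
  shows "t *\<^sub>R x \<in> cone_set K"
    and "tensor_form A (t *\<^sub>R x) + t ^ (CARD('m) - 1) * ((t *\<^sub>R x) \<bullet> q) = 0"
proof -
  show "t *\<^sub>R x \<in> cone_set K"
    using x t conicD[OF conic_cone_set[of K], of x t] by (simp add: SOL_def)
  have "tensor_form A (t *\<^sub>R x) + t ^ (CARD('m) - 1) * ((t *\<^sub>R x) \<bullet> q)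
      = t * t ^ (CARD('m) - 1) * (x \<bullet> (tensor_apply A x + q))"
    by (simp add: tensor_form_def tensor_apply_scaleR inner_add_right algebra_simps)
  then show "tensor_form A (t *\<^sub>R x) + t ^ (CARD('m) - 1) * ((t *\<^sub>R x) \<bullet> q) = 0"
    using x by (simp add: SOL_def)
qed

text \<open>
  By regularity no unit vector solves the normalized equation at \<open>t = 0\<close>, and the tube lemma
  carries this over to a neighborhood of the data and to an interval \<open>0 \<le> t < e\<close>. Nearby problems
  thus have no solutions of norm greater than \<open>1 / e\<close>.
\<close>

lemma SOL_locally_bounded:
  fixes A0 :: "('m::{finite,linorder}, 'n::finite) tensor"
  assumes m: "CARD('m) \<ge> 2" and reg: "regular K0 A0"
  obtains N where "open N" "(K0, q0, A0) \<in> N" "bounded (\<Union>(K, q, A)\<in>N. SOL K q A)"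
proof -
  define G :: "((('n ccone \<times> (real^'n) \<times> ('m, 'n) tensor) \<times> real) \<times> (real^'n)) set" where
    "G = {(((K, q, A), t), u). infdist u (cone_set K) = 0
      \<and> tensor_form A u + t ^ (CARD('m) - 1) * (u \<bullet> q) = 0}"
  have "closed G"
    unfolding G_def case_prod_unfold tensor_form_def
    by (intro closed_Collect_conj closed_Collect_eq continuous_intros)
  have away: "{((K0, q0, A0), 0)} \<times> sphere 0 1 \<subseteq> - G"
    using reg m by (auto simp: G_def regular_def in_cone_set_iff_infdist[symmetric] power_0_left)
  then obtain X where X: "((K0, q0, A0), 0) \<in> X" "open X" "X \<times> sphere 0 1 \<subseteq> - G"
    using Elementary_Topology.tube_lemma[OF compact_sphere open_Compl[OF \<open>closed G\<close>] away]
    by (elim exE conjE)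
  obtain N T where NT: "open N" "open T" "((K0, q0, A0), 0) \<in> N \<times> T" "N \<times> T \<subseteq> X"
    using X(2,1) by (rule open_prod_elim)
  then have N: "open N" "(K0, q0, A0) \<in> N" and T: "open T" "0 \<in> T" by simp_all
  obtain e where e: "e > 0" "ball 0 e \<subseteq> T" using T open_contains_ball by blast
  have "norm x \<le> 1 / e" if w: "(K, q, A) \<in> N" and x: "x \<in> SOL K q A" for K q A x
  proof (rule ccontr)
    assume "\<not> norm x \<le> 1 / e"
    moreover from this e(1) have pos: "norm x > 0"
      by (auto simp: not_le less_imp_le)
    ultimately have "1 / norm x < e"
      using e(1) by (simp add: field_simps)
    then have "1 / norm x \<in> T" using e(2) pos by auto
    then have "((K, q, A), 1 / norm x) \<in> X" using w by (intro subsetD[OF NT(4)] SigmaI)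
    moreover have "(1 / norm x) *\<^sub>R x \<in> sphere 0 1" using pos by simp
    ultimately have "(((K, q, A), 1 / norm x), (1 / norm x) *\<^sub>R x) \<in> - G"
      by (intro subsetD[OF X(3)] SigmaI)
    moreover have "1 / norm x > 0" using pos by simp
    note SOL_normalized[OF x this]
    then have "(((K, q, A), 1 / norm x), (1 / norm x) *\<^sub>R x) \<in> G"
      unfolding G_def in_cone_set_iff_infdist mem_Collect_eq prod.case by (rule conjI)
    ultimately show False by simp
  qed
  then have "bounded (\<Union>(K, q, A)\<in>N. SOL K q A)"
    by (auto intro!: boundedI[where B = "1 / e"])
  with N show thesis by (rule that)
qed

section \<open>Upper semicontinuity\<close>

lemma upper_semicontinuous_at_if_closed_graph:
  fixes \<Psi> :: "'w::topological_space \<Rightarrow> 'y::heine_borel set"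
  assumes graph: "closed {(w, y). y \<in> \<Psi> w}"
    and N: "open N" "w0 \<in> N" and bdd: "bounded (\<Union>w\<in>N. \<Psi> w)"
  shows "upper_semicontinuous_at \<Psi> w0"
  unfolding upper_semicontinuous_at_def
proof (intro allI impI)
  fix U assume U: "open U \<and> \<Psi> w0 \<subseteq> U"
  let ?C = "closure (\<Union>w\<in>N. \<Psi> w) - U"
  have "compact ?C"
    using bdd U by (simp add: compact_diff compact_closure)
  moreover have "open (- {(w, y). y \<in> \<Psi> w})"
    using graph by (rule open_Compl)
  moreover have "{w0} \<times> ?C \<subseteq> - {(w, y). y \<in> \<Psi> w}"
    using U by auto
  ultimately have "\<exists>X. w0 \<in> X \<and> open X \<and> X \<times> ?C \<subseteq> - {(w, y). y \<in> \<Psi> w}"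
    by (rule Elementary_Topology.tube_lemma)
  then obtain X where X: "w0 \<in> X" "open X" "X \<times> ?C \<subseteq> - {(w, y). y \<in> \<Psi> w}"
    by (elim exE conjE)
  have "\<Psi> w \<subseteq> U" if "w \<in> X \<inter> N" for w
  proof
    fix y assume y: "y \<in> \<Psi> w"
    then have "y \<in> (\<Union>w\<in>N. \<Psi> w)" using that by auto
    then have "y \<in> closure (\<Union>w\<in>N. \<Psi> w)" by (rule subsetD[OF closure_subset])
    moreover have "(w, y) \<notin> X \<times> ?C" using y subsetD[OF X(3), of "(w, y)"] by auto
    ultimately show "y \<in> U" using that by simp
  qed
  then show "\<forall>\<^sub>F w in nhds w0. \<Psi> w \<subseteq> U"
    unfolding eventually_nhds using X(1,2) N by (intro exI[of _ "X \<inter> N"]) (simp add: open_Int)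
qed

lemma upper_semicontinuous_at_SOL:
  fixes A0 :: "('m::{finite,linorder}, 'n::finite) tensor"
  assumes "CARD('m) \<ge> 2" "regular K0 A0"
  shows "upper_semicontinuous_at (\<lambda>(K, q, A). SOL K q A) (K0, q0, A0)"
proof -
  obtain N where N: "open N" "(K0, q0, A0) \<in> N" "bounded (\<Union>(K, q, A)\<in>N. SOL K q A)"
    using SOL_locally_bounded[OF assms] .
  \<comment> \<open>The graph is closed as a set of nested tuples; regroup them as parameter and solution.\<close>
  let ?G = "{(K :: 'n ccone, q, A :: ('m, 'n) tensor, x). x \<in> SOL K q A}"
  let ?r = "\<lambda>((K, q, A), x). (K, q, A, x)"
  have "continuous_on UNIV (?r :: ('n ccone \<times> (real^'n) \<times> ('m, 'n) tensor) \<times> (real^'n) \<Rightarrow> _)"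
    unfolding case_prod_unfold by (intro continuous_intros)
  then have "closed (?r -` ?G)"
    using closed_graph_SOL by (rule closed_vimage[rotated])
  also have "?r -` ?G = {(w, x). x \<in> (case w of (K, q, A) \<Rightarrow> SOL K q A)}"
    by auto
  finally show ?thesis
    using N by (rule upper_semicontinuous_at_if_closed_graph)
qed

theorem theorem5p1:
  assumes "CARD('m::{finite,linorder}) \<ge> 2"
  shows
    "closed {(K :: 'n::finite ccone, q :: real^'n, A :: ('m, 'n) tensor, x :: real^'n).
        x \<in> SOL K q A}
     \<and> (\<forall>(K0 :: 'n ccone) (q0 :: real^'n) (A0 :: ('m, 'n) tensor). regular K0 A0 \<longrightarrow>
          (\<exists>N. (K0, q0, A0) \<in> interior N \<and> bounded (\<Union>(K, q, A)\<in>N. SOL K q A)))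
     \<and> (\<forall>(K0 :: 'n ccone) (q0 :: real^'n) (A0 :: ('m, 'n) tensor). regular K0 A0 \<longrightarrow>
          upper_semicontinuous_at (\<lambda>(K, q, A). SOL K q A) (K0, q0, A0))"
proof (intro conjI allI impI closed_graph_SOL upper_semicontinuous_at_SOL[OF assms])
  fix K0 :: "'n ccone" and q0 :: "real^'n" and A0 :: "('m, 'n) tensor"
  assume "regular K0 A0"
  with assms obtain N
    where "open N" "(K0, q0, A0) \<in> N" "bounded (\<Union>(K, q, A)\<in>N. SOL K q A)"
    by (rule SOL_locally_bounded)
  then show "\<exists>N. (K0, q0, A0) \<in> interior N \<and> bounded (\<Union>(K, q, A)\<in>N. SOL K q A)"
    by (intro exI[of _ N]) (simp add: interior_open)
qed

end
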